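(* For every $\epsilon\in(0,1)$, the binary erasure channel $\mathrm{BEC}(\epsilon)$ with erasure probability $\epsilon$ satisfies $$C_I(\epsilon)\ \geq\ 0.104\, C_{Sh}(\epsilon),$$ where $C_I(\epsilon)$ is the interactive capacity and $C_{Sh}(\epsilon)$ the Shannon capacity of $\mathrm{BEC}(\epsilon)$.
   Context: The channel $\mathrm{BEC}(\epsilon)$ takes an input bit and outputs that bit with probability $1-\epsilon$ and an erasure symbol $\perp$ with probability $\epsilon$, independently over uses. Its Shannon capacity is $C_{Sh}(\epsilon)=1-\epsilon$. Protocols. A (noiseless, alternating) protocol $\pi$ of communication complexity $CC(\pi)=n_0$ between Alice (input $x_A$) and Bob (input $x_B$) consists of $n_0$ one-bit transmissions; Alice transmits in odd rounds and Bob in even rounds. In round $r$ the sender $P\in\{A,B\}$ sends $m_r=\pi(x_P,m^{r-1})\in\{0,1\}$, where $m^{r-1}=(m_1,\dots,m_{r-1})$ is the string of bits exchanged so far. The output (transcript) of $\pi$ is $m^{n_0}$. Simulations. A simulation $\tilde\pi$ of $\pi$ over $\mathrm{BEC}(\epsilon)$ is an interactive protocol in which every transmitted bit passes through an independent use of $\mathrm{BEC}(\epsilon)$. The order of speaking is fixed beforehand (non-adaptive) but need not be alternating. Each transmitted bit depends on the sender's input, on everything the sender has sent and received so far, and on $\pi$. $CC(\tilde\pi)$ is the total number of bits transmitted. At the end Alice and Bob output estimates $\tilde m_A^{n_0}$, $\tilde m_B^{n_0}$ of $m^{n_0}$, each based on $\pi$, the party's own input and the party's own sent and received symbols. An error occurs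 if $\tilde m_A^{n_0}\neq m^{n_0}$ or $\tilde m_B^{n_0}\neq m^{n_0}$. $P_e(\tilde\pi)$ is the probability of error over the channel erasures (maximum over the inputs $x_A,x_B$). Capacity. $R\ge 0$ is an achievable interactive coding rate for $\mathrm{BEC}(\epsilon)$ if for any sequence of protocols $\pi_{n_0}$, $n_0\ge1$, with $CC(\pi_{n_0})=n_0$, there is a sequence of simulations $\tilde\pi_{n_0}$ of $\pi_{n_0}$ over $\mathrm{BEC}(\epsilon)$ with $\frac{n_0}{CC(\tilde\pi_{n_0})}\to R$ and $P_e(\tilde\pi_{n_0})\to0$ as $n_0\to\infty$. The interactive capacity $C_I(\epsilon)$ is the supremum of all achievable interactive coding rates for $\mathrm{BEC}(\epsilon)$. *)

theory Defs
  imports "HOL-Probability.Probability"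
begin

section \<open>Discrete memoryless channels and the erasure channel\<close>

definition BEC :: "real \<Rightarrow> bool \<Rightarrow> bool option pmf" where
  "BEC \<epsilon> b = map_pmf (\<lambda>erased. if erased then None else Some b) (bernoulli_pmf \<epsilon>)"

text \<open>The joint law of channel input and output when the input has law \<open>p\<close>.\<close>

definition channel_joint :: "('x \<Rightarrow> 'y pmf) \<Rightarrow> 'x pmf \<Rightarrow> ('x \<times> 'y) pmf" where
  "channel_joint W p = bind_pmf p (\<lambda>x. map_pmf (Pair x) (W x))"

text \<open>Capacity in bits per channel use. For finite alphabets the mutual informations are bounded,
  so the supremum over the reals is the true one.\<close>

definition shannon_capacity :: "('x::finite \<Rightarrow> 'y::finite pmf) \<Rightarrow> real" where
  "shannon_capacity W =
     (SUP p. prob_space.mutual_information (measure_pmf (channel_joint W p)) 2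
               (count_space UNIV) (count_space UNIV) fst snd)"


section \<open>Noiseless alternating protocols\<close>

text \<open>The types \<open>'a\<close> and \<open>'b\<close> are the sets of inputs of Alice and of Bob. The second
  argument of the message functions is the list of bits exchanged so far, oldest first.\<close>

record ('a, 'b) protocol =
  CC :: nat
  msg_A :: "'a \<Rightarrow> bool list \<Rightarrow> bool"
  msg_B :: "'b \<Rightarrow> bool list \<Rightarrow> bool"

text \<open>Rounds are numbered from 1: Alice speaks in odd rounds, that is, whenever an even number
  of bits has been exchanged.\<close>

primrec partial_transcript :: "('a, 'b) protocol \<Rightarrow> 'a \<Rightarrow> 'b \<Rightarrow> nat \<Rightarrow> bool list" where
  "partial_transcript \<pi> x\<^sub>A x\<^sub>B 0 = []"
| "partial_transcript \<pi> x\<^sub>A x\<^sub>B (Suc k) =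
     (let m = partial_transcript \<pi> x\<^sub>A x\<^sub>B k
      in m @ [if odd (Suc k) then msg_A \<pi> x\<^sub>A m else msg_B \<pi> x\<^sub>B m])"

definition transcript :: "('a, 'b) protocol \<Rightarrow> 'a \<Rightarrow> 'b \<Rightarrow> bool list" where
  "transcript \<pi> x\<^sub>A x\<^sub>B = partial_transcript \<pi> x\<^sub>A x\<^sub>B (CC \<pi>)"


section \<open>Simulations over the erasure channel\<close>

datatype party = Alice | Bob

text \<open>A party's view lists what it has sent and received, oldest first. The sender of a bit records
  only the bit itself and does not learn whether it was erased.\<close>

datatype event = Sent bool | Received "bool option"

text \<open>The field \<open>order\<close> is the sequence of speakers, fixed independently of inputs and
  erasures. The functions \<open>est_A\<close> and \<open>est_B\<close> produce the final estimates of the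
  transcript. Dependence on the simulated protocol needs no argument, since a simulation is chosen
  once that protocol is given.\<close>

record ('a, 'b) simulation =
  order :: "party list"
  send_A :: "'a \<Rightarrow> event list \<Rightarrow> bool"
  send_B :: "'b \<Rightarrow> event list \<Rightarrow> bool"
  est_A :: "'a \<Rightarrow> event list \<Rightarrow> bool list"
  est_B :: "'b \<Rightarrow> event list \<Rightarrow> bool list"

definition CC_sim :: "('a, 'b) simulation \<Rightarrow> nat" where
  "CC_sim \<sigma> = length (order \<sigma>)"

text \<open>The joint law of the final views, starting from the views \<open>v\<^sub>A\<close>, \<open>v\<^sub>B\<close> with the speakers
  given by the list still to come.\<close>

primrec run_from :: "real \<Rightarrow> ('a, 'b) simulation \<Rightarrow> 'a \<Rightarrow> 'b \<Rightarrow> party list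
    \<Rightarrow> event list \<Rightarrow> event list \<Rightarrow> (event list \<times> event list) pmf" where
  "run_from \<epsilon> \<sigma> x\<^sub>A x\<^sub>B [] v\<^sub>A v\<^sub>B = return_pmf (v\<^sub>A, v\<^sub>B)"
| "run_from \<epsilon> \<sigma> x\<^sub>A x\<^sub>B (P # Ps) v\<^sub>A v\<^sub>B =
     (case P of
        Alice \<Rightarrow> let b = send_A \<sigma> x\<^sub>A v\<^sub>A in
          bind_pmf (BEC \<epsilon> b)
            (\<lambda>y. run_from \<epsilon> \<sigma> x\<^sub>A x\<^sub>B Ps (v\<^sub>A @ [Sent b]) (v\<^sub>B @ [Received y]))
      | Bob \<Rightarrow> let b = send_B \<sigma> x\<^sub>B v\<^sub>B in
          bind_pmf (BEC \<epsilon> b)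
            (\<lambda>y. run_from \<epsilon> \<sigma> x\<^sub>A x\<^sub>B Ps (v\<^sub>A @ [Received y]) (v\<^sub>B @ [Sent b])))"

definition views :: "real \<Rightarrow> ('a, 'b) simulation \<Rightarrow> 'a \<Rightarrow> 'b \<Rightarrow> (event list \<times> event list) pmf" where
  "views \<epsilon> \<sigma> x\<^sub>A x\<^sub>B = run_from \<epsilon> \<sigma> x\<^sub>A x\<^sub>B (order \<sigma>) [] []"

text \<open>For a fixed simulation only finitely many error probabilities occur, so the supremum over
  the inputs is a maximum.\<close>

definition error_prob :: "real \<Rightarrow> ('a, 'b) protocol \<Rightarrow> ('a, 'b) simulation \<Rightarrow> real" where
  "error_prob \<epsilon> \<pi> \<sigma> =
     (SUP (x\<^sub>A, x\<^sub>B). measure_pmf.prob (views \<epsilon> \<sigma> x\<^sub>A x\<^sub>B)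
        {(v\<^sub>A, v\<^sub>B). est_A \<sigma> x\<^sub>A v\<^sub>A \<noteq> transcript \<pi> x\<^sub>A x\<^sub>B \<or> est_B \<sigma> x\<^sub>B v\<^sub>B \<noteq> transcript \<pi> x\<^sub>A x\<^sub>B})"


section \<open>Interactive capacity\<close>

text \<open>Sequences are indexed by \<open>nat\<close>; the entry at index 0 is irrelevant. A simulation
  with no transmissions is excluded because the ratio would then be a division by zero.

  The input types are parameters because a definition cannot quantify over types. Protocols whose
  inputs come from different sets are covered by types that contain all of these sets.\<close>

definition achievable_rate :: "'a itself \<Rightarrow> 'b itself \<Rightarrow> real \<Rightarrow> real \<Rightarrow> bool" where
  "achievable_rate TA TB \<epsilon> R \<longleftrightarrow>
     0 \<le> R \<and>
     (\<forall>\<pi> :: nat \<Rightarrow> ('a, 'b) protocol. (\<forall>n\<ge>1. CC (\<pi> n) = n) \<longrightarrow>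
        (\<exists>\<sigma> :: nat \<Rightarrow> ('a, 'b) simulation.
           (\<forall>n\<ge>1. 0 < CC_sim (\<sigma> n)) \<and>
           (\<lambda>n. real n / real (CC_sim (\<sigma> n))) \<longlonglongrightarrow> R \<and>
           (\<lambda>n. error_prob \<epsilon> (\<pi> n) (\<sigma> n)) \<longlonglongrightarrow> 0))"

text \<open>The supremum is taken in the extended reals: over input types with too few elements every
  rate is achievable, and a real-valued supremum would be meaningless there.\<close>

definition interactive_capacity :: "'a itself \<Rightarrow> 'b itself \<Rightarrow> real \<Rightarrow> ereal" where
  "interactive_capacity TA TB \<epsilon> = (SUP R \<in> {R. achievable_rate TA TB \<epsilon> R}. ereal R)"


section \<open>Shannon capacity of the erasure channel\<close>

lemma pmf_BEC:
  assumes "0 \<le> \<epsilon>" "\<epsilon> \<le> 1"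
  shows "pmf (BEC \<epsilon> b) y = (case y of None \<Rightarrow> \<epsilon> | Some c \<Rightarrow> if c = b then 1 - \<epsilon> else 0)"
proof -
  have BEC_eq: "BEC \<epsilon> b =
      bind_pmf (bernoulli_pmf \<epsilon>) (\<lambda>e. return_pmf (if e then None else Some b))"
    by (simp add: BEC_def map_pmf_def)
  show ?thesis
    unfolding BEC_eq pmf_bind using assms
    by (subst integral_bernoulli_pmf) (auto split: option.split)
qed

lemma pmf_channel_joint: "pmf (channel_joint W p) (x, y) = pmf p x * pmf (W x) y"
proof -
  have pt: "pmf (map_pmf (Pair x') (W x')) (x, y) = (if x' = x then pmf (W x) y else 0)" for x'
  proof (cases "x' = x")
    case True
    then show ?thesis by (simp add: pmf_map_inj' inj_on_def)
  next
    case False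
    then show ?thesis by (auto intro: pmf_map_outside)
  qed
  have "pmf (channel_joint W p) (x, y) =
      (\<integral>x'. (if x' = x then pmf (W x) y else 0) \<partial>measure_pmf p)"
    unfolding channel_joint_def pmf_bind pt ..
  also have "\<dots> = pmf p x * pmf (W x) y"
    by (subst integral_measure_pmf_real[where A = "{x}"]) (auto split: if_splits)
  finally show ?thesis .
qed

lemma prob_channel_joint_fst:
  fixes W :: "'x::finite \<Rightarrow> 'y::finite pmf"
  shows "measure (measure_pmf (channel_joint W p)) (fst -` {x}) = pmf p x"
proof -
  have "map_pmf fst (channel_joint W p) = p"
    by (simp add: channel_joint_def map_bind_pmf map_pmf_comp bind_return_pmf')
  then show ?thesis by (metis pmf_map)
qed

lemma prob_channel_joint_snd:
  fixes W :: "'x::finite \<Rightarrow> 'y::finite pmf"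
  shows "measure (measure_pmf (channel_joint W p)) (snd -` {y}) = (\<Sum>x\<in>UNIV. pmf p x * pmf (W x) y)"
proof -
  have "map_pmf snd (channel_joint W p) = bind_pmf p W"
    by (simp add: channel_joint_def map_bind_pmf map_pmf_comp)
  then have "measure (measure_pmf (channel_joint W p)) (snd -` {y}) = pmf (bind_pmf p W) y"
    by (metis pmf_map)
  then show ?thesis
    by (simp add: pmf_bind integral_measure_pmf_real[where A = UNIV] mult.commute)
qed

lemma mutual_information_channel_joint:
  fixes W :: "'x::finite \<Rightarrow> 'y::finite pmf"
  shows "prob_space.mutual_information (measure_pmf (channel_joint W p)) 2
           (count_space UNIV) (count_space UNIV) fst snd =
         (\<Sum>x\<in>UNIV. \<Sum>y\<in>UNIV. pmf p x * pmf (W x) y *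
            log 2 (pmf p x * pmf (W x) y / (pmf p x * (\<Sum>x\<in>UNIV. pmf p x * pmf (W x) y))))"
proof -
  interpret information_space "measure_pmf (channel_joint W p)" 2
    by unfold_locales simp
  have sf: "simple_function (measure_pmf (channel_joint W p)) f" for f :: "'x \<times> 'y \<Rightarrow> 'z"
    by (simp add: simple_function_def)
  have X: "simple_distributed (measure_pmf (channel_joint W p)) fst (pmf p)"
    by (rule measure_pmf.simple_distributedI[OF sf]) (simp_all add: prob_channel_joint_fst)
  have Y: "simple_distributed (measure_pmf (channel_joint W p)) snd
      (\<lambda>y. \<Sum>x\<in>UNIV. pmf p x * pmf (W x) y)"
    by (rule measure_pmf.simple_distributedI[OF sf])
       (simp_all add: prob_channel_joint_snd sum_nonneg)
  have XY: "simple_distributed (measure_pmf (channel_joint W p)) (\<lambda>z. (fst z, snd z))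
      (pmf (channel_joint W p))"
    by (rule measure_pmf.simple_distributedI[OF sf]) (simp_all add: pmf.rep_eq vimage_def)
  show ?thesis
    using mutual_information_simple_distributed[OF X Y XY]
    by (simp add: sum.cartesian_product pmf_channel_joint case_prod_beta flip: UNIV_Times_UNIV)
qed

theorem shannon_capacity_BEC:
  assumes "0 < \<epsilon>" "\<epsilon> < 1"
  shows "shannon_capacity (BEC \<epsilon>) = 1 - \<epsilon>"
proof -
  define I where "I p = prob_space.mutual_information (measure_pmf (channel_joint (BEC \<epsilon>) p)) 2
    (count_space UNIV) (count_space UNIV) fst snd" for p
  have I_eq: "I p = (1 - \<epsilon>) * (\<Sum>x\<in>UNIV. pmf p x * log 2 (1 / pmf p x))" for p
  proof -
    have sum1: "pmf p True + pmf p False = 1"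
      using sum_pmf_eq_1[of "UNIV :: bool set" p, OF finite subset_UNIV]
      by (simp add: UNIV_bool add.commute)
    have er: "pmf p True * \<epsilon> + pmf p False * \<epsilon> = \<epsilon>"
      by (metis sum1 distrib_right mult_1)
    have UNIV_opt: "(UNIV :: bool option set) = {None, Some True, Some False}"
      by (auto simp: UNIV_option_conv UNIV_bool)
    have er': "pmf p False * \<epsilon> + pmf p True * \<epsilon> = \<epsilon>"
      using er by (simp add: add.commute)
    show ?thesis
      unfolding I_def mutual_information_channel_joint
      unfolding UNIV_opt UNIV_bool
      using assms er er'
      by (simp add: pmf_BEC)
         (cases "pmf p True = 0"; cases "pmf p False = 0"; simp add: field_simps)
  qed
  have le: "I p \<le> 1 - \<epsilon>" for p
  proof -
    have sum1: "pmf p True + pmf p False = 1"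
      using sum_pmf_eq_1[of "UNIV :: bool set" p, OF finite subset_UNIV]
      by (simp add: UNIV_bool add.commute)
    have ent: "t * log 2 (1 / t) \<le> t + (1/2 - t) / ln 2" if "0 \<le> t" for t :: real
    proof (cases "t = 0")
      case False
      with that have t: "0 < t" by simp
      have "ln (1 / (2 * t)) \<le> 1 / (2 * t) - 1"
        using t by (intro ln_le_minus_one) simp
      then have "t * ln (1 / (2 * t)) \<le> t * (1 / (2 * t) - 1)"
        using t by (intro mult_left_mono) auto
      also have "\<dots> = 1/2 - t" using t by (simp add: field_simps)
      finally have "t * ln (1 / (2 * t)) / ln 2 \<le> (1/2 - t) / ln 2"
        by (intro divide_right_mono) auto
      moreover have "t * log 2 (1 / t) = t + t * ln (1 / (2 * t)) / ln 2"
        using t by (simp add: log_def ln_div ln_mult field_simps)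
      ultimately show ?thesis by simp
    qed simp
    have "(\<Sum>x\<in>UNIV. pmf p x * log 2 (1 / pmf p x)) \<le> (\<Sum>x\<in>UNIV. pmf p x + (1/2 - pmf p x) / ln 2)"
      by (intro sum_mono ent) simp
    also have "\<dots> = (pmf p True + pmf p False) + (1 - (pmf p True + pmf p False)) / ln 2"
      by (simp add: UNIV_bool field_simps)
    also have "\<dots> = 1" by (simp add: sum1)
    finally show ?thesis
      unfolding I_eq using assms by (simp add: mult_left_le)
  qed
  have "I (bernoulli_pmf (1/2)) = 1 - \<epsilon>"
    unfolding I_eq by (simp add: UNIV_bool)
  then have "1 - \<epsilon> \<in> range I"
    by (metis rangeI)
  then have "(SUP p. I p) = 1 - \<epsilon>"
    by (rule cSup_eq_maximum) (use le in auto)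
  then show ?thesis
    unfolding shannon_capacity_def I_def .
qed

end

theory Submission
  imports Defs "HOL-Real_Asymp.Real_Asymp"
begin

text \<open>
  The simulation is stop-and-wait ARQ with the noiseless protocol serving as its own acknowledgement.
  The parties alternately transmit blocks of \<open>2 k\<close> bits: \<open>k\<close> copies of the latest
  message and \<open>k\<close> copies of a one-bit sequence number. The number of messages exchanged by the
  two parties never differs by more than one, so one bit suffices to tell a new message from a repeated
  one. A block is delivered with probability \<open>p = (1 - \<epsilon>^k)\<^sup>2\<close>, and each failed
  delivery costs two blocks (the useless reply and the repetition), so a protocol bit takes
  \<open>1 + 2 (1 - p) / p = (2 - p) / p\<close> blocks on average. Hence every rate below
  \<open>p / (2 k (2 - p))\<close> is achievable, and choosing \<open>k = 1\<close> for \<open>\<epsilon> \<le> 0.6\<close> and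
  \<open>\<epsilon>^k\<close> in \<open>(0.12, 0.2]\<close> otherwise makes this exceed \<open>0.104 (1 - \<epsilon>)\<close>.
\<close>

section \<open>Choice of the block length and of the decay factor\<close>

text \<open>With \<open>p = (1 - \<epsilon> ^ k)\<^sup>2\<close> the inequality says that
  \<open>0.104 * (1 - \<epsilon>)\<close> lies below \<open>p / (2 k (2 - p))\<close>. For
  \<open>\<epsilon>\<close> near 1 the length \<open>k\<close> is large, but
  \<open>k * (1 - \<epsilon>)\<close> stays bounded.\<close>

lemma exists_block_length:
  fixes \<epsilon> :: real
  assumes "0 < \<epsilon>" and "\<epsilon> < 1"
  obtains k where "0 < k" and "(2 - (1 - \<epsilon> ^ k)\<^sup>2) * (2 * real k * (0.104 * (1 - \<epsilon>))) < (1 - \<epsilon> ^ k)\<^sup>2"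
proof (cases "\<epsilon> \<le> 0.6")
  case True
  define u where "u = 1 - \<epsilon>"
  have u: "0.4 \<le> u" using True by (simp add: u_def)
  \<comment> \<open>The goal for \<open>k = 1\<close>, divided by \<open>u\<close>; at
    \<open>u = 0.4\<close> the left side is about 0.383.\<close>
  have "0.208 * (2 - u\<^sup>2) < u"
    using mult_mono[OF u u] u by (simp add: power2_eq_square)
  then have "u * (0.208 * (2 - u\<^sup>2)) < u * u"
    using u by (intro mult_strict_left_mono) auto
  then have "(2 - (1 - \<epsilon> ^ 1)\<^sup>2) * (2 * real 1 * (0.104 * (1 - \<epsilon>))) < (1 - \<epsilon> ^ 1)\<^sup>2"
    by (simp add: u_def power2_eq_square algebra_simps)
  then show ?thesis using that[of 1] by simp
next
  case False
  have "\<exists>k. \<epsilon> ^ k \<le> 0.2"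
    using real_arch_pow_inv[of "0.2" \<epsilon>] assms by (force intro: less_imp_le)
  define k where "k = (LEAST k. \<epsilon> ^ k \<le> 0.2)"
  have le: "\<epsilon> ^ k \<le> 0.2"
    unfolding k_def by (rule LeastI_ex) fact
  have k: "0 < k" using le by (cases k) auto
  have "0.2 < \<epsilon> ^ (k - 1)"
    using not_less_Least[of "k - 1" "\<lambda>k. \<epsilon> ^ k \<le> 0.2"] k by (simp add: k_def)
  \<comment> \<open>By minimality \<open>k - 1\<close> copies are not enough, and one more factor
    \<open>\<epsilon>\<close> shrinks the power by less than 0.6.\<close>
  then have "0.6 * 0.2 < \<epsilon> * \<epsilon> ^ (k - 1)"
    using False by (intro mult_strict_mono) auto
  then have ge: "0.12 < \<epsilon> ^ k" using k by (simp add: power_eq_if)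
  have "\<epsilon> \<le> exp (- (1 - \<epsilon>))" using exp_ge_add_one_self[of "- (1 - \<epsilon>)"] by simp
  then have "\<epsilon> ^ k \<le> exp (- (1 - \<epsilon>)) ^ k" using assms by (intro power_mono) auto
  also have "\<dots> = exp (- (real k * (1 - \<epsilon>)))"
    by (simp add: exp_of_nat_mult [symmetric] algebra_simps)
  finally have e1: "0.12 < exp (- (real k * (1 - \<epsilon>)))" using ge by simp
  have e2: "exp (- 2.2) \<le> (0.12 :: real)"
  proof -
    \<comment> \<open>Splitting 2.2 into 44 equal pieces makes \<open>1 + x \<le> exp x\<close>
      sharp enough: \<open>1.05 ^ 44\<close> exceeds 8.5, while \<open>1 / 0.12\<close> is below
      8.4.\<close>
    have "(1.05 :: real) ^ 44 \<le> exp 0.05 ^ 44"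
      using exp_ge_add_one_self[of "0.05"] by (intro power_mono) auto
    also have "\<dots> = exp 2.2" by (simp add: exp_of_nat_mult [symmetric])
    finally have "1 / 0.12 \<le> exp (2.2 :: real)" by (simp add: power_divide)
    then show ?thesis by (simp add: exp_minus field_simps)
  qed
  have kb: "real k * (1 - \<epsilon>) < 2.2"
    using order.strict_trans1[OF e2 e1] by simp
  have p: "0.64 \<le> (1 - \<epsilon> ^ k)\<^sup>2"
    using le power_mono[of "0.8" "1 - \<epsilon> ^ k" 2] by (simp add: power2_eq_square)
  have "(2 - (1 - \<epsilon> ^ k)\<^sup>2) * (0.208 * (real k * (1 - \<epsilon>))) \<le> 1.36 * (0.208 * 2.2)"
    using p kb assms by (intro mult_mono) auto
  also have "\<dots> < 0.64" by simp
  finally show ?thesis using p k by (intro that[of k]) (auto simp: algebra_simps)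
qed

text \<open>Equality holds at \<open>\<rho> = 1\<close>, where the logarithmic derivative of the left-hand side is
  \<open>\<kappa> + 1 - 2 / p > 0\<close>; so a \<open>\<rho>\<close> slightly below 1 works.\<close>

lemma exists_decay_factor:
  fixes p \<kappa> :: real
  assumes "0 < p" "p \<le> 1" "2 < p * (\<kappa> + 1)"
  obtains \<rho> where "0 < \<rho>" "\<rho> < 1" "1 - p < \<rho>\<^sup>2" "\<rho> powr \<kappa> * (p * \<rho> / (\<rho>\<^sup>2 - (1 - p))) < 1"
proof -
  \<comment> \<open>With the denominator cleared, the last claim says that this function is smaller
    at \<open>\<rho>\<close> than its value \<open>p - 1\<close> at 1.\<close>
  have "((\<lambda>\<rho>. p * \<rho> powr (\<kappa> + 1) - \<rho>\<^sup>2) has_real_derivative p * (\<kappa> + 1) - 2) (at 1)"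
    by (auto intro!: derivative_eq_intros)
  from DERIV_pos_inc_left[OF this] assms obtain d where d: "0 < d"
    "\<And>h. 0 < h \<Longrightarrow> h < d \<Longrightarrow> p * (1 - h) powr (\<kappa> + 1) - (1 - h)\<^sup>2 < p * 1 powr (\<kappa> + 1) - 1\<^sup>2"
    by auto
  \<comment> \<open>The bound \<open>p / 4\<close> ensures \<open>2 * h < p\<close> and hence
    \<open>1 - p < \<rho>\<^sup>2\<close>; the bound \<open>1 / 2\<close> keeps
    \<open>\<rho>\<close> positive.\<close>
  define h where "h = Min {d / 2, 1 / 2, p / 4}"
  have h: "0 < h" "h < d" "h \<le> 1 / 2" "h \<le> p / 4" using d(1) assms by (auto simp: h_def min_def)
  define \<rho> where "\<rho> = 1 - h"
  have \<rho>: "0 < \<rho>" "\<rho> < 1" using h by (auto simp: \<rho>_def)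
  have "1 - 2 * h \<le> \<rho>\<^sup>2" by (simp add: \<rho>_def power2_eq_square algebra_simps)
  then have sq: "1 - p < \<rho>\<^sup>2" using h assms by simp
  have "p * (\<rho> powr \<kappa> * \<rho>) < \<rho>\<^sup>2 - (1 - p)"
    using d(2)[OF h(1,2)] \<rho> by (simp add: \<rho>_def [symmetric] powr_add)
  then have "\<rho> powr \<kappa> * (p * \<rho> / (\<rho>\<^sup>2 - (1 - p))) < 1"
    using sq by (simp add: field_simps)
  with \<rho> sq that show ?thesis by blast
qed

section \<open>The stop-and-wait simulation\<close>

fun other :: "party \<Rightarrow> party" where
  "other Alice = Bob"
| "other Bob = Alice"

lemma other_neq [simp]: "other P \<noteq> P" "P \<noteq> other P"
  by (cases P; simp)+

lemma other_other [simp]: "other (other P) = P"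
  by (cases P) auto

text \<open>\<open>Sent\<close> events yield \<open>None\<close>, so a party can feed its own blocks
  to the same decoder without changing its state.\<close>

definition got :: "event list \<Rightarrow> bool option" where
  "got es = (if Received (Some True) \<in> set es then Some True
             else if Received (Some False) \<in> set es then Some False else None)"

text \<open>A party that knows \<open>l\<close> bits, its own next message included, expects a new message from
  a sender knowing \<open>l + 1\<close> bits; a repetition comes from one knowing \<open>l - 1\<close>. The tag of a
  sender knowing \<open>m\<close> bits is the parity of \<open>m div 2\<close>, which separates the two cases.\<close>

definition extend :: "nat \<Rightarrow> (bool list \<Rightarrow> bool) \<Rightarrow> bool list \<Rightarrow> event list \<Rightarrow> bool list" where
  "extend k f t es =
     (case (got (take k es), got (drop k es)) of
        (Some b, Some c) \<Rightarrow> if c = odd (Suc (length t) div 2) then t @ [b, f (t @ [b])] else t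
      | _ \<Rightarrow> t)"

text \<open>A sending function receives only the view, so the state is recomputed from the initial
  knowledge \<open>t\<close> by a fold over the first \<open>j\<close> blocks.\<close>

primrec known :: "nat \<Rightarrow> (bool list \<Rightarrow> bool) \<Rightarrow> bool list \<Rightarrow> event list \<Rightarrow> nat \<Rightarrow> bool list" where
  "known k f t v 0 = t"
| "known k f t v (Suc j) = extend k f (known k f t v j) (take (2 * k) (drop (j * (2 * k)) v))"

definition current :: "nat \<Rightarrow> (bool list \<Rightarrow> bool) \<Rightarrow> bool list \<Rightarrow> event list \<Rightarrow> bool list" where
  "current k f t v = known k f t v (length v div (2 * k))"

text \<open>In his first block, if nothing has arrived yet, Bob sends the junk value \<open>last []\<close>; its tag
  makes Alice discard it.\<close>

definition next_bit :: "nat \<Rightarrow> (bool list \<Rightarrow> bool) \<Rightarrow> bool list \<Rightarrow> event list \<Rightarrow> bool" where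
  "next_bit k f t v =
     (let s = current k f t v in
      if length v mod (2 * k) < k then last s else odd (length s div 2))"

primrec blocks :: "nat \<Rightarrow> party \<Rightarrow> nat \<Rightarrow> party list" where
  "blocks k P 0 = []"
| "blocks k P (Suc M) = replicate (2 * k) P @ blocks k (other P) M"

lemma length_blocks [simp]: "length (blocks k P M) = 2 * k * M"
  by (induction M arbitrary: P) auto

text \<open>Alice starts with her own first message, Bob with nothing. The parties may go on
  producing messages beyond the end of the protocol until the blocks run out, so the estimates are
  truncated.\<close>

definition stop_and_wait :: "('a, 'b) protocol \<Rightarrow> nat \<Rightarrow> nat \<Rightarrow> ('a, 'b) simulation" where
  "stop_and_wait \<pi> k M =
     \<lparr>order = blocks k Alice M,
      send_A = (\<lambda>x. next_bit k (msg_A \<pi> x) [msg_A \<pi> x []]),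
      send_B = (\<lambda>x. next_bit k (msg_B \<pi> x) []),
      est_A = (\<lambda>x v. take (CC \<pi>) (current k (msg_A \<pi> x) [msg_A \<pi> x []] v)),
      est_B = (\<lambda>x v. take (CC \<pi>) (current k (msg_B \<pi> x) [] v))\<rparr>"

lemma known_append: "j * (2 * k) \<le> length v \<Longrightarrow> known k f t (v @ w) j = known k f t v j"
  by (induction j) (auto simp: extend_def)

text \<open>An incomplete block does not affect \<open>current\<close>. Hence all
  \<open>2 * k\<close> bits of a block are determined at its start, and the block is a fixed word
  sent through the channel.\<close>

lemma next_bit_in_block:
  assumes "length v = j * (2 * k)" "length w < 2 * k"
  shows "next_bit k f t (v @ w) =
    (if length w < k then last (current k f t v) else odd (length (current k f t v) div 2))"
proof -
  have "length (v @ w) div (2 * k) = j" "length (v @ w) mod (2 * k) = length w"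
    "length v div (2 * k) = j"
    using assms by auto
  then show ?thesis using assms(1) by (simp add: next_bit_def current_def known_append Let_def)
qed

lemma current_append_block:
  assumes "length v = j * (2 * k)" "length w = 2 * k" "0 < k"
  shows "current k f t (v @ w) = extend k f (current k f t v) w"
proof -
  have "length (v @ w) div (2 * k) = Suc j" "length v div (2 * k) = j"
    using assms by auto
  then show ?thesis using assms by (simp add: current_def known_append del: known.simps(1))
qed

lemma extend_sent: "extend k f t (map Sent bs) = t"
proof -
  have "got (take k (map Sent bs)) = None" by (auto simp: got_def dest: in_set_takeD)
  then show ?thesis by (simp add: extend_def)
qed

section \<open>One block through the erasure channel\<close>

primrec transmit :: "real \<Rightarrow> bool list \<Rightarrow> bool option list pmf" where
  "transmit \<epsilon> [] = return_pmf []"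
| "transmit \<epsilon> (b # bs) = bind_pmf (BEC \<epsilon> b) (\<lambda>y. map_pmf ((#) y) (transmit \<epsilon> bs))"

lemma transmit_append:
  "transmit \<epsilon> (bs @ cs) = map_pmf (\<lambda>(x, y). x @ y) (pair_pmf (transmit \<epsilon> bs) (transmit \<epsilon> cs))"
proof (induction bs)
  case Nil
  then show ?case by (simp add: pair_return_pmf1 map_pmf_comp)
next
  case (Cons b bs)
  then show ?case
    by (simp add: pair_pmf_def map_bind_pmf bind_map_pmf bind_assoc_pmf map_pmf_def bind_return_pmf)
qed

lemma length_transmit: "ys \<in> set_pmf (transmit \<epsilon> bs) \<Longrightarrow> length ys = length bs"
  by (induction bs arbitrary: ys) auto

lemma set_transmit_replicate:
  "ys \<in> set_pmf (transmit \<epsilon> (replicate k b)) \<Longrightarrow> set ys \<subseteq> {None, Some b}"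
proof (induction k arbitrary: ys)
  case (Suc k)
  then obtain y zs where "ys = y # zs" "y \<in> set_pmf (BEC \<epsilon> b)" "zs \<in> set_pmf (transmit \<epsilon> (replicate k b))"
    by auto
  with Suc.IH[of zs] show ?case by (auto simp: BEC_def)
qed simp

lemma prob_transmit_all_erased:
  assumes "0 \<le> \<epsilon>" "\<epsilon> \<le> 1"
  shows "measure_pmf.prob (transmit \<epsilon> (replicate k b)) {ys. set ys \<subseteq> {None}} = \<epsilon> ^ k"
proof (induction k)
  case 0
  then show ?case by simp
next
  case (Suc k)
  have "measure_pmf.prob (transmit \<epsilon> (replicate (Suc k) b)) {ys. set ys \<subseteq> {None}} =
    measure_pmf.expectation (bernoulli_pmf \<epsilon>) (\<lambda>e. if e then \<epsilon> ^ k else 0)"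
    unfolding replicate_Suc transmit.simps BEC_def bind_map_pmf measure_pmf_bind
    apply (subst measure_pmf.measure_bind[where N = "count_space UNIV"])
      apply (auto simp: Suc[simplified] vimage_def measure_pmf_in_subprob_algebra intro!: Bochner_Integration.integral_cong)
    done
  also have "\<dots> = \<epsilon> ^ Suc k"
    using assms by (subst integral_bernoulli_pmf) auto
  finally show ?case .
qed

definition delivered :: "nat \<Rightarrow> bool option list \<Rightarrow> bool" where
  "delivered k ys \<longleftrightarrow> \<not> set (take k ys) \<subseteq> {None} \<and> \<not> set (drop k ys) \<subseteq> {None}"

lemma prob_delivered:
  assumes "0 \<le> \<epsilon>" "\<epsilon> \<le> 1"
  shows "measure_pmf.prob (transmit \<epsilon> (replicate k b @ replicate k c)) {ys. delivered k ys} = (1 - \<epsilon> ^ k)\<^sup>2"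
proof -
  let ?E = "{ys :: bool option list. set ys \<subseteq> {None}}"
  have compl: "measure_pmf.prob (transmit \<epsilon> (replicate k d)) (- ?E) = 1 - \<epsilon> ^ k" for d
    using measure_pmf.prob_compl[of ?E "transmit \<epsilon> (replicate k d)"]
    by (simp add: prob_transmit_all_erased[OF assms] Compl_eq_Diff_UNIV)
  have "measure_pmf.prob (transmit \<epsilon> (replicate k b @ replicate k c)) {ys. delivered k ys} =
    measure_pmf.prob (pair_pmf (transmit \<epsilon> (replicate k b)) (transmit \<epsilon> (replicate k c))) ((- ?E) \<times> (- ?E))"
    \<comment> \<open>\<open>delivered\<close> cuts at position \<open>k\<close>, which is the seam
      of the two words only because outputs have the length of the inputs; so the events agree
      almost surely.\<close>
    unfolding transmit_append measure_map_pmf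
    by (intro measure_pmf.finite_measure_eq_AE AE_pmfI) 
       (auto simp: delivered_def dest!: length_transmit)
  also have "\<dots> = (1 - \<epsilon> ^ k)\<^sup>2"
    by (subst measure_pmf_prob_product) (auto simp: compl power2_eq_square)
  finally show ?thesis .
qed

lemma got_map_Received:
  assumes "set ys \<subseteq> {None, Some b}"
  shows "got (map Received ys) = (if set ys \<subseteq> {None} then None else Some b)"
  using assms by (cases b) (auto simp: got_def)

text \<open>The channel erases but never flips, so any surviving copy reveals its bit; a half
  without survivors makes \<open>extend\<close> leave \<open>t\<close> alone.\<close>

lemma extend_received:
  assumes "ys \<in> set_pmf (transmit \<epsilon> (replicate k b @ replicate k c))"
  shows "extend k f t (map Received ys) =
    (if delivered k ys \<and> c = odd (Suc (length t) div 2) then t @ [b, f (t @ [b])] else t)"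
proof -
  obtain y z where yz: "ys = y @ z" "y \<in> set_pmf (transmit \<epsilon> (replicate k b))"
    "z \<in> set_pmf (transmit \<epsilon> (replicate k c))"
    using assms by (auto simp: transmit_append)
  have "length y = k" using length_transmit[OF yz(2)] by simp
  then show ?thesis
    using yz(1) set_transmit_replicate[OF yz(2)] set_transmit_replicate[OF yz(3)]
    by (simp add: extend_def delivered_def got_map_Received)
qed

definition send :: "('a, 'b) simulation \<Rightarrow> 'a \<Rightarrow> 'b \<Rightarrow> party \<Rightarrow> event list \<Rightarrow> bool" where
  "send \<sigma> x\<^sub>A x\<^sub>B P = (case P of Alice \<Rightarrow> send_A \<sigma> x\<^sub>A | Bob \<Rightarrow> send_B \<sigma> x\<^sub>B)"

text \<open>The sender does not observe erasures, so its view within the block is deterministic and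
  the channel uses collapse into one draw from \<open>transmit\<close>. Indexing the views by
  \<open>party\<close> covers both speakers at once.\<close>

lemma run_from_block:
  assumes "\<And>i. i < length bs \<Longrightarrow> send \<sigma> x\<^sub>A x\<^sub>B P (V P @ map Sent (take i bs)) = bs ! i"
  shows "run_from \<epsilon> \<sigma> x\<^sub>A x\<^sub>B (replicate (length bs) P @ Ps) (V Alice) (V Bob) =
    bind_pmf (transmit \<epsilon> bs) (\<lambda>ys.
      let W = (\<lambda>Q. V Q @ (if Q = P then map Sent bs else map Received ys))
      in run_from \<epsilon> \<sigma> x\<^sub>A x\<^sub>B Ps (W Alice) (W Bob))"
  using assms
proof (induction bs arbitrary: V)
  case Nil
  then show ?case by (simp add: bind_return_pmf)
next
  case (Cons b bs)
  define U where "U y = (\<lambda>Q. V Q @ [if Q = P then Sent b else Received y])" for y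
  have b: "send \<sigma> x\<^sub>A x\<^sub>B P (V P) = b" using Cons.prems[of 0] by simp
  have step: "run_from \<epsilon> \<sigma> x\<^sub>A x\<^sub>B (P # Qs) (V Alice) (V Bob) =
    bind_pmf (BEC \<epsilon> b) (\<lambda>y. run_from \<epsilon> \<sigma> x\<^sub>A x\<^sub>B Qs (U y Alice) (U y Bob))" for Qs
    using b by (cases P) (auto simp: send_def U_def)
  have IH: "run_from \<epsilon> \<sigma> x\<^sub>A x\<^sub>B (replicate (length bs) P @ Ps) (U y Alice) (U y Bob) =
    bind_pmf (transmit \<epsilon> bs) (\<lambda>ys.
      let W = (\<lambda>Q. U y Q @ (if Q = P then map Sent bs else map Received ys))
      in run_from \<epsilon> \<sigma> x\<^sub>A x\<^sub>B Ps (W Alice) (W Bob))" for y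
    using Cons.prems[of "Suc i" for i] by (intro Cons.IH) (auto simp: U_def)
  show ?case
    unfolding list.size(4) add_Suc_right add_0_right replicate_Suc append_Cons step IH
    by (cases P) (simp_all add: U_def bind_assoc_pmf bind_map_pmf Let_def)
qed

lemma prob_bind_le:
  fixes u w :: real
  assumes "\<And>y. y \<in> set_pmf P \<Longrightarrow> y \<in> S \<Longrightarrow> measure_pmf.prob (F y) E \<le> u"
    and "\<And>y. y \<in> set_pmf P \<Longrightarrow> y \<notin> S \<Longrightarrow> measure_pmf.prob (F y) E \<le> w"
  shows "measure_pmf.prob (bind_pmf P F) E
    \<le> measure_pmf.prob P S * u + (1 - measure_pmf.prob P S) * w"
proof -
  have integrable_ind: "integrable P (indicator A :: _ \<Rightarrow> real)" for A
    by (rule measure_pmf.integrable_const_bound[where B = 1]) auto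
  have "measure_pmf.prob (bind_pmf P F) E = measure_pmf.expectation P (\<lambda>y. measure_pmf.prob (F y) E)"
    unfolding measure_pmf_bind
    by (subst measure_pmf.measure_bind[where N = "count_space UNIV"])
       (auto simp: measure_pmf_in_subprob_algebra)
  also have "\<dots> \<le> measure_pmf.expectation P (\<lambda>y. indicator S y * u + indicator (- S) y * w)"
  proof (intro integral_mono_AE AE_pmfI)
    show "integrable P (\<lambda>y. measure_pmf.prob (F y) E)"
      by (rule measure_pmf.integrable_const_bound[where B = 1]) auto
    show "integrable P (\<lambda>y. indicator S y * u + indicator (- S) y * w)"
      by (rule measure_pmf.integrable_const_bound[where B = "\<bar>u\<bar> + \<bar>w\<bar>"]) (auto simp: indicator_def)
  qed (use assms in \<open>auto simp: indicator_def\<close>)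
  also have "\<dots> = measure_pmf.prob P S * u + measure_pmf.prob P (- S) * w"
    by (subst Bochner_Integration.integral_add)
       (simp_all add: integrable_ind)
  also have "measure_pmf.prob P (- S) = 1 - measure_pmf.prob P S"
    using measure_pmf.prob_compl[of S P] by (simp add: Compl_eq_Diff_UNIV)
  finally show ?thesis .
qed


section \<open>Synchronisation of the parties and the failure bound\<close>

definition message :: "('a, 'b) protocol \<Rightarrow> 'a \<Rightarrow> 'b \<Rightarrow> party \<Rightarrow> bool list \<Rightarrow> bool" where
  "message \<pi> x\<^sub>A x\<^sub>B P = (case P of Alice \<Rightarrow> msg_A \<pi> x\<^sub>A | Bob \<Rightarrow> msg_B \<pi> x\<^sub>B)"

definition knowledge :: "('a, 'b) protocol \<Rightarrow> 'a \<Rightarrow> 'b \<Rightarrow> nat \<Rightarrow> party \<Rightarrow> event list \<Rightarrow> bool list" where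
  "knowledge \<pi> x\<^sub>A x\<^sub>B k P =
     current k (message \<pi> x\<^sub>A x\<^sub>B P) (case P of Alice \<Rightarrow> [msg_A \<pi> x\<^sub>A []] | Bob \<Rightarrow> [])"

definition speaker :: "nat \<Rightarrow> party" where
  "speaker l = (if even l then Alice else Bob)"

lemma speaker_Suc [simp]: "speaker (Suc l) = other (speaker l)"
  by (simp add: speaker_def)

lemma length_partial_transcript [simp]: "length (partial_transcript \<pi> x\<^sub>A x\<^sub>B l) = l"
  by (induction l) (auto simp: Let_def)

lemma partial_transcript_message:
  "partial_transcript \<pi> x\<^sub>A x\<^sub>B (Suc l) = partial_transcript \<pi> x\<^sub>A x\<^sub>B l @
    [message \<pi> x\<^sub>A x\<^sub>B (speaker l) (partial_transcript \<pi> x\<^sub>A x\<^sub>B l)]"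
  by (simp add: Let_def message_def speaker_def)

lemma take_partial_transcript:
  "n \<le> l \<Longrightarrow> take n (partial_transcript \<pi> x\<^sub>A x\<^sub>B l) = partial_transcript \<pi> x\<^sub>A x\<^sub>B n"
  by (induction l) (auto simp: Let_def le_Suc_eq)

text \<open>The state at a block boundary: \<open>l Q\<close> is the number of bits that
  \<open>Q\<close> knows, its own next message included, so the first bit \<open>Q\<close> lacks is
  always due from the other party.\<close>

definition in_sync :: "('a, 'b) protocol \<Rightarrow> 'a \<Rightarrow> 'b \<Rightarrow> nat \<Rightarrow> (party \<Rightarrow> event list) \<Rightarrow> (party \<Rightarrow> nat) \<Rightarrow> bool" where
  "in_sync \<pi> x\<^sub>A x\<^sub>B k V l \<longleftrightarrow>
     (\<exists>j. \<forall>Q. length (V Q) = j * (2 * k)) \<and>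
     (\<forall>Q. knowledge \<pi> x\<^sub>A x\<^sub>B k Q (V Q) = partial_transcript \<pi> x\<^sub>A x\<^sub>B (l Q) \<and> speaker (l Q) = other Q)"

definition failure :: "('a, 'b) protocol \<Rightarrow> ('a, 'b) simulation \<Rightarrow> 'a \<Rightarrow> 'b \<Rightarrow> (event list \<times> event list) set" where
  "failure \<pi> \<sigma> x\<^sub>A x\<^sub>B =
     {(v\<^sub>A, v\<^sub>B). est_A \<sigma> x\<^sub>A v\<^sub>A \<noteq> transcript \<pi> x\<^sub>A x\<^sub>B \<or> est_B \<sigma> x\<^sub>B v\<^sub>B \<noteq> transcript \<pi> x\<^sub>A x\<^sub>B}"

lemma in_sync_step:
  fixes V :: "party \<Rightarrow> event list" and l :: "party \<Rightarrow> nat"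
  assumes bs_def: "bs = replicate k (last (partial_transcript \<pi> x\<^sub>A x\<^sub>B (l P))) @ replicate k (odd (l P div 2))"
    and sync: "in_sync \<pi> x\<^sub>A x\<^sub>B k V l" and "0 < k"
    and adj: "l P = Suc (l (other P)) \<or> l (other P) = Suc (l P)"
    and ys: "ys \<in> set_pmf (transmit \<epsilon> bs)"
  shows "in_sync \<pi> x\<^sub>A x\<^sub>B k (\<lambda>Q. V Q @ (if Q = P then map Sent bs else map Received ys))
    (if delivered k ys \<and> l P = Suc (l (other P)) then l(other P := Suc (l P)) else l)"
proof -
  obtain j where j: "length (V Q) = j * (2 * k)" for Q
    using sync by (auto simp: in_sync_def)
  have kn: "knowledge \<pi> x\<^sub>A x\<^sub>B k Q (V Q) = partial_transcript \<pi> x\<^sub>A x\<^sub>B (l Q)" "speaker (l Q) = other Q" for Q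
    using sync by (auto simp: in_sync_def)
  have len: "length ys = 2 * k" "length bs = 2 * k"
    using length_transmit[OF ys] by (auto simp: bs_def)
  have sent: "knowledge \<pi> x\<^sub>A x\<^sub>B k P (V P @ map Sent bs) = partial_transcript \<pi> x\<^sub>A x\<^sub>B (l P)"
    using kn(1)[of P] current_append_block[OF j, of "map Sent bs"] len \<open>0 < k\<close>
    by (simp add: knowledge_def extend_sent)
  \<comment> \<open>In the stale case \<open>Suc (l (other P))\<close> equals
    \<open>l P + 2\<close>; its half exceeds that of \<open>l P\<close> by exactly one, so the
    parities differ.\<close>
  have tag: "odd (l P div 2) = odd (Suc (l (other P)) div 2) \<longleftrightarrow> l P = Suc (l (other P))"
    using adj by (auto simp: div_Suc) presburger+
  have received: "knowledge \<pi> x\<^sub>A x\<^sub>B k (other P) (V (other P) @ map Received ys) =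
    partial_transcript \<pi> x\<^sub>A x\<^sub>B (if delivered k ys \<and> l P = Suc (l (other P)) then Suc (l P) else l (other P))"
  proof -
    have "knowledge \<pi> x\<^sub>A x\<^sub>B k (other P) (V (other P) @ map Received ys) =
      extend k (message \<pi> x\<^sub>A x\<^sub>B (other P)) (partial_transcript \<pi> x\<^sub>A x\<^sub>B (l (other P))) (map Received ys)"
      using kn(1)[of "other P"] current_append_block[OF j, of "map Received ys"] len \<open>0 < k\<close>
      by (simp add: knowledge_def)
    also note extend_received[OF ys[unfolded bs_def]]
    finally show ?thesis
      unfolding length_partial_transcript tag using kn(2)[of P] kn(2)[of "other P"]
      \<comment> \<open>Acceptance advances the transcript by two bits: the message of
        \<open>P\<close> and the answer that the receiver computes from it.\<close>
      by (simp add: partial_transcript_message del: partial_transcript.simps)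
  qed
  have all: "(\<forall>Q. R Q) \<longleftrightarrow> R P \<and> R (other P)" for R
    by (cases P) (auto, (metis party.exhaust)+)
  show ?thesis
    unfolding in_sync_def
  proof (intro conjI)
    show "\<exists>j. \<forall>Q. length (V Q @ (if Q = P then map Sent bs else map Received ys)) = j * (2 * k)"
      using j len by (intro exI[of _ "Suc j"]) auto
    show "\<forall>Q. knowledge \<pi> x\<^sub>A x\<^sub>B k Q (V Q @ (if Q = P then map Sent bs else map Received ys)) =
        partial_transcript \<pi> x\<^sub>A x\<^sub>B ((if delivered k ys \<and> l P = Suc (l (other P))
          then l(other P := Suc (l P)) else l) Q) \<and>
        speaker ((if delivered k ys \<and> l P = Suc (l (other P)) then l(other P := Suc (l P)) else l) Q) = other Q"
      unfolding all using sent received kn(2) by auto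
  qed
qed

text \<open>With \<open>M\<close> blocks to go and \<open>d\<close> protocol bits missing, the potential is
  \<open>\<rho>^M z^d\<close> if the next block carries a new message. If it cannot, because the previous block
  was lost, the potential is that of the situation one block later. The equation \<open>balance\<close>
  makes the potential a martingale. The exponent \<open>d\<close> is a real that may be negative: truncating
  it at 0 would destroy the martingale property.\<close>

lemma prob_failure_run:
  fixes V :: "party \<Rightarrow> event list" and l :: "party \<Rightarrow> nat" and \<rho> z :: real
  assumes \<epsilon>: "0 \<le> \<epsilon>" "\<epsilon> \<le> 1" and k: "0 < k"
  defines "p \<equiv> (1 - \<epsilon> ^ k)\<^sup>2"
  assumes \<rho>: "0 < \<rho>" "\<rho> \<le> 1" and z: "1 \<le> z" and balance: "p * \<rho> / z + (1 - p) = \<rho>\<^sup>2"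
    and \<sigma>_def: "\<sigma> = stop_and_wait \<pi> k N"
    and sync: "in_sync \<pi> x\<^sub>A x\<^sub>B k V l"
  shows "(l P = Suc (l (other P)) \<longrightarrow>
      measure_pmf.prob (run_from \<epsilon> \<sigma> x\<^sub>A x\<^sub>B (blocks k P M) (V Alice) (V Bob)) (failure \<pi> \<sigma> x\<^sub>A x\<^sub>B)
        \<le> \<rho> ^ M * z powr (real (CC \<pi>) - real (l (other P)))) \<and>
    (l (other P) = Suc (l P) \<longrightarrow>
      measure_pmf.prob (run_from \<epsilon> \<sigma> x\<^sub>A x\<^sub>B (blocks k P M) (V Alice) (V Bob)) (failure \<pi> \<sigma> x\<^sub>A x\<^sub>B)
        \<le> \<rho> ^ M / \<rho> * z powr (real (CC \<pi>) - real (l P)))"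
  using sync
proof (induction M arbitrary: P V l)
  case 0
  \<comment> \<open>With no blocks left, either some party lacks a bit and the bound is at least 1,
    or both know the whole transcript and failure is impossible.\<close>
  define r where "r = min (l P) (l (other P))"
  have le: "measure_pmf.prob (run_from \<epsilon> \<sigma> x\<^sub>A x\<^sub>B (blocks k P 0) (V Alice) (V Bob)) (failure \<pi> \<sigma> x\<^sub>A x\<^sub>B)
      \<le> z powr (real (CC \<pi>) - real r)"
  proof (cases "r < CC \<pi>")
    case True
    have "measure_pmf.prob (run_from \<epsilon> \<sigma> x\<^sub>A x\<^sub>B (blocks k P 0) (V Alice) (V Bob)) (failure \<pi> \<sigma> x\<^sub>A x\<^sub>B) \<le> 1"
      by simp
    also have "1 \<le> z powr (real (CC \<pi>) - real r)"
      using z True by (intro ge_one_powr_ge_zero) auto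
    finally show ?thesis .
  next
    case False
    then have "CC \<pi> \<le> l Alice" "CC \<pi> \<le> l Bob" by (cases P; simp add: r_def)+
    then have "(V Alice, V Bob) \<notin> failure \<pi> \<sigma> x\<^sub>A x\<^sub>B"
      using 0 by (auto simp: failure_def \<sigma>_def stop_and_wait_def in_sync_def knowledge_def message_def
        transcript_def take_partial_transcript dest: spec[of _ Alice] spec[of _ Bob])
    then show ?thesis by simp
  qed
  have "1 \<le> 1 / \<rho>" using \<rho> by simp
  then have "z powr (real (CC \<pi>) - real r) \<le> 1 / \<rho> * z powr (real (CC \<pi>) - real r)"
    using mult_right_mono[of 1 "1 / \<rho>" "z powr (real (CC \<pi>) - real r)"] by simp
  with le show ?case by (auto simp: r_def)
next
  case (Suc M)
  show ?case
  proof (cases "l P = Suc (l (other P)) \<or> l (other P) = Suc (l P)")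
    case False
    then show ?thesis by blast
  next
    case adj: True
    define bs where "bs = replicate k (last (partial_transcript \<pi> x\<^sub>A x\<^sub>B (l P))) @ replicate k (odd (l P div 2))"
    define W where "W ys = (\<lambda>Q. V Q @ (if Q = P then map Sent bs else map Received ys))" for ys
    define l' where "l' ys = (if delivered k ys \<and> l P = Suc (l (other P)) then l(other P := Suc (l P)) else l)" for ys
    obtain j where j: "length (V Q) = j * (2 * k)" for Q
      using Suc.prems by (auto simp: in_sync_def)
    have kn: "knowledge \<pi> x\<^sub>A x\<^sub>B k P (V P) = partial_transcript \<pi> x\<^sub>A x\<^sub>B (l P)"
      using Suc.prems by (auto simp: in_sync_def)
    have len: "length bs = 2 * k" by (simp add: bs_def)
    have "send \<sigma> x\<^sub>A x\<^sub>B P (V P @ map Sent (take i bs)) = bs ! i" if "i < length bs" for i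
    proof -
      have "send \<sigma> x\<^sub>A x\<^sub>B P v = next_bit k (message \<pi> x\<^sub>A x\<^sub>B P) (case P of Alice \<Rightarrow> [msg_A \<pi> x\<^sub>A []] | Bob \<Rightarrow> []) v" for v
        by (cases P) (auto simp: send_def \<sigma>_def stop_and_wait_def message_def)
      then show ?thesis
        using that len kn next_bit_in_block[OF j, of "map Sent (take i bs)"]
        by (auto simp: bs_def knowledge_def nth_append)
    qed
    from run_from_block[where V = V, OF this]
    have run: "run_from \<epsilon> \<sigma> x\<^sub>A x\<^sub>B (replicate (2 * k) P @ Ps) (V Alice) (V Bob) =
      bind_pmf (transmit \<epsilon> bs) (\<lambda>ys. run_from \<epsilon> \<sigma> x\<^sub>A x\<^sub>B Ps (W ys Alice) (W ys Bob))" for Ps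
      by (simp add: len W_def)
    have sync': "in_sync \<pi> x\<^sub>A x\<^sub>B k (W ys) (l' ys)" if "ys \<in> set_pmf (transmit \<epsilon> bs)" for ys
      unfolding W_def l'_def by (rule in_sync_step[OF bs_def Suc.prems k adj that])
    let ?err = "\<lambda>ys. measure_pmf.prob (run_from \<epsilon> \<sigma> x\<^sub>A x\<^sub>B (blocks k (other P) M) (W ys Alice) (W ys Bob)) (failure \<pi> \<sigma> x\<^sub>A x\<^sub>B)"
    note IH = Suc.IH[OF sync', of _ "other P", unfolded other_other]
    have bind_le: "measure_pmf.prob (run_from \<epsilon> \<sigma> x\<^sub>A x\<^sub>B (blocks k P (Suc M)) (V Alice) (V Bob)) (failure \<pi> \<sigma> x\<^sub>A x\<^sub>B)
        \<le> p * u + (1 - p) * w"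
      if "\<And>ys. ys \<in> set_pmf (transmit \<epsilon> bs) \<Longrightarrow> delivered k ys \<Longrightarrow> ?err ys \<le> u"
        "\<And>ys. ys \<in> set_pmf (transmit \<epsilon> bs) \<Longrightarrow> \<not> delivered k ys \<Longrightarrow> ?err ys \<le> w" for u w
    proof -
      have "measure_pmf.prob (transmit \<epsilon> bs) {ys. delivered k ys} = p"
        unfolding bs_def p_def by (rule prob_delivered[OF \<epsilon>])
      then show ?thesis
        unfolding blocks.simps run
        using prob_bind_le[of "transmit \<epsilon> bs" "{ys. delivered k ys}", OF that] by simp
    qed
    show ?thesis
    proof (intro conjI impI)
      assume fresh: "l P = Suc (l (other P))"
      define d where "d = real (CC \<pi>) - real (l (other P))"
      \<comment> \<open>After delivery the receiver is one bit ahead, so its reply is again new and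
        one bit fewer is missing. After a loss its reply is stale and \<open>d\<close> is
        unchanged.\<close>
      have "?err ys \<le> \<rho> ^ M * z powr (d - 1)" if "ys \<in> set_pmf (transmit \<epsilon> bs)" "delivered k ys" for ys
        using IH[OF that(1)] that(2) fresh by (simp add: l'_def d_def algebra_simps)
      moreover have "?err ys \<le> \<rho> ^ M / \<rho> * z powr d" if "ys \<in> set_pmf (transmit \<epsilon> bs)" "\<not> delivered k ys" for ys
        using IH[OF that(1)] that(2) fresh by (simp add: l'_def d_def)
      ultimately have "measure_pmf.prob (run_from \<epsilon> \<sigma> x\<^sub>A x\<^sub>B (blocks k P (Suc M)) (V Alice) (V Bob)) (failure \<pi> \<sigma> x\<^sub>A x\<^sub>B)
        \<le> p * (\<rho> ^ M * z powr (d - 1)) + (1 - p) * (\<rho> ^ M / \<rho> * z powr d)"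
        by (rule bind_le)
      also have "\<dots> = \<rho> ^ M / \<rho> * z powr d * (p * \<rho> / z + (1 - p))"
        using z \<rho> by (simp add: powr_diff field_simps)
      also have "\<dots> = \<rho> ^ Suc M * z powr d"
        unfolding balance using \<rho> by (simp add: power2_eq_square)
      finally show "measure_pmf.prob (run_from \<epsilon> \<sigma> x\<^sub>A x\<^sub>B (blocks k P (Suc M)) (V Alice) (V Bob)) (failure \<pi> \<sigma> x\<^sub>A x\<^sub>B)
        \<le> \<rho> ^ Suc M * z powr (real (CC \<pi>) - real (l (other P)))" by (simp add: d_def)
    next
      assume stale: "l (other P) = Suc (l P)"
      \<comment> \<open>A stale block changes nothing, delivered or not; the next block is then a
        new message, so both branches get the same bound.\<close>
      have "?err ys \<le> \<rho> ^ M * z powr (real (CC \<pi>) - real (l P))" if "ys \<in> set_pmf (transmit \<epsilon> bs)" for ys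
        using IH[OF that(1)] stale by (simp add: l'_def)
      then have "measure_pmf.prob (run_from \<epsilon> \<sigma> x\<^sub>A x\<^sub>B (blocks k P (Suc M)) (V Alice) (V Bob)) (failure \<pi> \<sigma> x\<^sub>A x\<^sub>B)
        \<le> p * (\<rho> ^ M * z powr (real (CC \<pi>) - real (l P))) + (1 - p) * (\<rho> ^ M * z powr (real (CC \<pi>) - real (l P)))"
        by (intro bind_le)
      then show "measure_pmf.prob (run_from \<epsilon> \<sigma> x\<^sub>A x\<^sub>B (blocks k P (Suc M)) (V Alice) (V Bob)) (failure \<pi> \<sigma> x\<^sub>A x\<^sub>B)
        \<le> \<rho> ^ Suc M / \<rho> * z powr (real (CC \<pi>) - real (l P))"
        using \<rho> by (simp add: algebra_simps)
    qed
  qed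
qed

section \<open>From the failure bound to an achievable rate\<close>

lemma error_prob_stop_and_wait:
  fixes \<rho> z :: real
  assumes \<epsilon>: "0 \<le> \<epsilon>" "\<epsilon> \<le> 1" and k: "0 < k"
    and \<rho>: "0 < \<rho>" "\<rho> \<le> 1" and z: "1 \<le> z"
    and balance: "(1 - \<epsilon> ^ k)\<^sup>2 * \<rho> / z + (1 - (1 - \<epsilon> ^ k)\<^sup>2) = \<rho>\<^sup>2"
  shows "error_prob \<epsilon> \<pi> (stop_and_wait \<pi> k M) \<le> \<rho> ^ M * z powr real (CC \<pi>)"
  unfolding error_prob_def
proof (rule cSUP_least)
  fix x :: "'a \<times> 'b"
  obtain x\<^sub>A x\<^sub>B where x: "x = (x\<^sub>A, x\<^sub>B)" by (cases x)
  \<comment> \<open>Initially only Alice knows her first message, so the first block is new and all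
    \<open>CC \<pi>\<close> bits are missing.\<close>
  let ?l = "\<lambda>P. case P of Alice \<Rightarrow> 1 | Bob \<Rightarrow> 0"
  have "in_sync \<pi> x\<^sub>A x\<^sub>B k (\<lambda>_. []) ?l"
    by (auto simp: in_sync_def knowledge_def current_def speaker_def Let_def split: party.split)
  from prob_failure_run[OF \<epsilon> k \<rho> z balance refl this, of Alice M M]
  show "(case x of (x\<^sub>A, x\<^sub>B) \<Rightarrow> measure_pmf.prob (views \<epsilon> (stop_and_wait \<pi> k M) x\<^sub>A x\<^sub>B)
      {(v\<^sub>A, v\<^sub>B). est_A (stop_and_wait \<pi> k M) x\<^sub>A v\<^sub>A \<noteq> transcript \<pi> x\<^sub>A x\<^sub>B \<or>
        est_B (stop_and_wait \<pi> k M) x\<^sub>B v\<^sub>B \<noteq> transcript \<pi> x\<^sub>A x\<^sub>B}) \<le> \<rho> ^ M * z powr real (CC \<pi>)"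
    by (simp add: x views_def failure_def stop_and_wait_def)
qed simp

lemma error_prob_nonneg: "0 \<le> error_prob \<epsilon> \<pi> \<sigma>"
  unfolding error_prob_def
  by (rule cSUP_upper2[where x = undefined]) (auto intro!: bdd_aboveI[where M = 1] split: prod.split)

lemma achievable_rate_stop_and_wait:
  fixes R :: real
  assumes \<epsilon>: "0 < \<epsilon>" "\<epsilon> < 1" and k: "0 < k" and R: "0 < R"
    and rate: "(2 - (1 - \<epsilon> ^ k)\<^sup>2) * (2 * real k * R) < (1 - \<epsilon> ^ k)\<^sup>2"
  shows "achievable_rate TYPE('a) TYPE('b) \<epsilon> R"
  unfolding achievable_rate_def
proof (intro conjI allI impI)
  show "0 \<le> R" using R by simp
next
  fix \<pi> :: "nat \<Rightarrow> ('a, 'b) protocol"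
  assume CC: "\<forall>n\<ge>1. CC (\<pi> n) = n"
  define p where "p = (1 - \<epsilon> ^ k)\<^sup>2"
  \<comment> \<open>Blocks per protocol bit at rate \<open>R\<close>. The hypothesis
    \<open>rate\<close> says that \<open>\<kappa>\<close> exceeds the mean cost
    \<open>(2 - p) / p\<close>, which leaves room for an exponentially small error.\<close>
  define \<kappa> where "\<kappa> = 1 / (2 * real k * R)"
  have \<kappa>: "0 < \<kappa>" using k R by (simp add: \<kappa>_def)
  have "\<epsilon> ^ k < 1" using \<epsilon> k by (simp add: power_less_one_iff)
  then have p: "0 < p" "p \<le> 1"
    using \<epsilon> by (auto simp: p_def power_le_one)
  have "2 < p * (\<kappa> + 1)"
    using rate k R by (simp add: \<kappa>_def p_def [symmetric] field_simps)
  then obtain \<rho> where \<rho>: "0 < \<rho>" "\<rho> < 1" "1 - p < \<rho>\<^sup>2" "\<rho> powr \<kappa> * (p * \<rho> / (\<rho>\<^sup>2 - (1 - p))) < 1"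
    using exists_decay_factor[OF p] by blast
  define z where "z = p * \<rho> / (\<rho>\<^sup>2 - (1 - p))"
  \<comment> \<open>The product equals \<open>p * \<rho> - (\<rho>\<^sup>2 - (1 - p))\<close>,
    numerator minus denominator of \<open>z\<close>.\<close>
  have "0 \<le> (1 - \<rho>) * (\<rho> + (1 - p))" using \<rho> p by simp
  then have z: "1 \<le> z" using \<rho> by (simp add: z_def field_simps power2_eq_square)
  have balance: "p * \<rho> / z + (1 - p) = \<rho>\<^sup>2" using \<rho> p by (simp add: z_def)
  define M where "M n = nat \<lceil>\<kappa> * real n\<rceil>" for n
  have M: "\<kappa> * real n \<le> real (M n)" "real (M n) \<le> \<kappa> * real n + 1" for n
    using \<kappa> by (auto simp: M_def of_nat_nat)
  define \<sigma> where "\<sigma> n = stop_and_wait (\<pi> n) k (M n)" for n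
  have CC_sim: "CC_sim (\<sigma> n) = 2 * k * M n" for n
    by (simp add: CC_sim_def \<sigma>_def stop_and_wait_def)
  have M_pos: "0 < M n" if "n \<ge> 1" for n
  proof -
    have "0 < \<kappa> * real n" using \<kappa> that by simp
    then show ?thesis using M(1)[of n] by linarith
  qed
  have "(\<lambda>n. real n / real (CC_sim (\<sigma> n))) \<longlonglongrightarrow> R"
  \<comment> \<open>Rounding up the number of blocks adds at most one block, which vanishes in the
    limit.\<close>
  proof (rule tendsto_sandwich)
    show "\<forall>\<^sub>F n in sequentially. real n / (2 * real k * (\<kappa> * real n + 1)) \<le> real n / real (CC_sim (\<sigma> n))"
      using eventually_ge_at_top[of 1]
    proof eventually_elim
      case (elim n)
      show ?case unfolding CC_sim of_nat_mult of_nat_numeral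
        using M(2)[of n] M_pos[OF elim] k by (intro divide_left_mono mult_left_mono mult_pos_pos) auto
    qed
    show "\<forall>\<^sub>F n in sequentially. real n / real (CC_sim (\<sigma> n)) \<le> R"
      using eventually_ge_at_top[of 1]
    proof eventually_elim
      case (elim n)
      have "real n / real (CC_sim (\<sigma> n)) \<le> real n / (2 * real k * (\<kappa> * real n))"
        unfolding CC_sim of_nat_mult of_nat_numeral
        using M(1)[of n] M_pos[OF elim] k elim \<kappa> by (intro divide_left_mono mult_left_mono mult_pos_pos) auto
      also have "\<dots> = R" using elim k R by (simp add: \<kappa>_def)
      finally show ?case .
    qed
    have "(\<lambda>n. real n / (2 * real k * (\<kappa> * real n + 1))) \<longlonglongrightarrow> 1 / (2 * real k * \<kappa>)"
      using k \<kappa> by (real_asymp simp: field_simps)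
    then show "(\<lambda>n. real n / (2 * real k * (\<kappa> * real n + 1))) \<longlonglongrightarrow> R"
      using k R by (simp add: \<kappa>_def)
  qed simp
  moreover have "(\<lambda>n. error_prob \<epsilon> (\<pi> n) (\<sigma> n)) \<longlonglongrightarrow> 0"
  proof (rule tendsto_sandwich[where f = "\<lambda>_. 0"])
    show "(\<lambda>n. (\<rho> powr \<kappa> * z) ^ n) \<longlonglongrightarrow> 0"
      using \<rho> z by (intro LIMSEQ_realpow_zero) (auto simp: z_def)
    show "\<forall>\<^sub>F n in sequentially. error_prob \<epsilon> (\<pi> n) (\<sigma> n) \<le> (\<rho> powr \<kappa> * z) ^ n"
      using eventually_ge_at_top[of 1]
    proof eventually_elim
      case (elim n)
      have "error_prob \<epsilon> (\<pi> n) (\<sigma> n) \<le> \<rho> ^ M n * z powr real (CC (\<pi> n))"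
        unfolding \<sigma>_def
        using \<epsilon> k \<rho> z balance by (intro error_prob_stop_and_wait) (auto simp: p_def)
      also have "\<dots> = \<rho> powr real (M n) * z ^ n"
        using CC elim \<rho> z by (simp add: powr_realpow)
      also have "\<dots> \<le> \<rho> powr (\<kappa> * real n) * z ^ n"
        using M(1)[of n] \<rho> z by (intro mult_right_mono powr_mono') auto
      also have "\<dots> = (\<rho> powr \<kappa> * z) ^ n"
        using \<rho> by (simp add: power_mult_distrib powr_powr [symmetric] powr_realpow)
      finally show ?case .
    qed
  qed (auto simp: error_prob_nonneg)
  ultimately show "\<exists>\<sigma>. (\<forall>n\<ge>1. 0 < CC_sim (\<sigma> n)) \<and>
      (\<lambda>n. real n / real (CC_sim (\<sigma> n))) \<longlonglongrightarrow> R \<and> (\<lambda>n. error_prob \<epsilon> (\<pi> n) (\<sigma> n)) \<longlonglongrightarrow> 0"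
    using CC_sim M_pos k by (intro exI[of _ \<sigma>]) auto
qed

theorem theorem1:
  fixes \<epsilon> :: real
  assumes "0 < \<epsilon>" and "\<epsilon> < 1"
  shows "interactive_capacity TYPE('a) TYPE('b) \<epsilon> \<ge> ereal (0.104 * shannon_capacity (BEC \<epsilon>))"
proof -
  obtain k where k: "0 < k"
    "(2 - (1 - \<epsilon> ^ k)\<^sup>2) * (2 * real k * (0.104 * (1 - \<epsilon>))) < (1 - \<epsilon> ^ k)\<^sup>2"
    using exists_block_length[OF assms] by blast
  have "achievable_rate TYPE('a) TYPE('b) \<epsilon> (0.104 * (1 - \<epsilon>))"
    using assms by (intro achievable_rate_stop_and_wait[OF assms k(1) _ k(2)]) simp
  then show ?thesis
    unfolding interactive_capacity_def shannon_capacity_BEC[OF assms]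
    by (intro SUP_upper) simp
qed

end
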